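(* Let $(\Xi,\rho,\theta,\Sigma)$ be a continuous groupoid action. Assume that $\Xi$ is locally compact, second countable and open. If $\sigma\in\Sigma$ has a compact orbit, then it is a periodic point.
   Context: All topological spaces are Hausdorff. A groupoid $\Xi$ is a small category in which all arrows are invertible; $X=\Xi^{(0)}$ is its unit space, $d,r:\Xi\to X$ are the source and range maps, and $\xi\eta$ is defined iff $d(\xi)=r(\eta)$. A topological groupoid is a groupoid with a (Hausdorff) topology making inversion and multiplication continuous (composable pairs carry the topology induced from $\Xi\times\Xi$); $X$ has the subspace topology. $\Xi$ is called open if $d:\Xi\to X$ is an open map. For $x\in X$, $\Xi_x=d^{-1}(\{x\})$. For $\mathsf A,\mathsf B\subset\Xi$, $\mathsf A\mathsf B=\{\xi\eta:\xi\in\mathsf A,\ \eta\in\mathsf B,\ d(\xi)=r(\eta)\}$. A continuous groupoid action $(\Xi,\rho,\theta,\Sigma)$ consists of a topological groupoid $\Xi$, a Hausdorff space $\Sigma$, a continuous surjection $\rho:\Sigma\to X$ (the anchor) and a continuous map $\theta:\{(\xi,\sigma)\in\Xi\times\Sigma: d(\xi)=\rho(\sigma)\}\to\Sigma$, $\theta_\xi(\sigma)=\xi\bullet\sigma$, with $\rho(\sigma)\bullet\sigma=\sigma$ and: if $d(\xi)=r(\eta)$ and $d(\eta)=\rho(\sigma)$ then $d(\xi)=\rho(\eta\bullet\sigma)$ and $(\xi\eta)\bullet\sigma=\xi\bullet(\eta\bullet\sigma)$. The orbit of $\sigma$ is $\mathfrak O_\sigma=\{\xi\bullet\sigma:\xi\in\Xi_{\rho(\sigma)}\}$;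 its stabilizer is $\widetilde\Xi_\sigma^\sigma=\{\xi\in\Xi_{\rho(\sigma)}:\xi\bullet\sigma=\sigma\}$. A subset $\mathsf A\subset\Xi_x$ is syndetic (in $\Xi_x$) if $\mathsf K\mathsf A=\Xi_x$ for some compact $\mathsf K\subset\Xi$. The point $\sigma$ is periodic if $\widetilde\Xi_\sigma^\sigma$ is syndetic in $\Xi_{\rho(\sigma)}$. *)

theory Defs
  imports "HOL-Analysis.Analysis"
begin

text \<open>
  A groupoid is given by its set of arrows \<open>G\<close>; objects are identified with their identity
  arrows, so the unit space \<open>X\<close> is a subset of \<open>G\<close>. The product \<open>m \<xi> \<eta>\<close> is meaningful only if
  \<open>d \<xi> = r \<eta>\<close>; its values elsewhere are unconstrained.
  The map \<open>i\<close> is inversion, which the axioms determine uniquely on \<open>G\<close>.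
\<close>

locale groupoid =
  fixes G :: "'g set" and X :: "'g set"
    and d :: "'g \<Rightarrow> 'g" and r :: "'g \<Rightarrow> 'g"
    and m :: "'g \<Rightarrow> 'g \<Rightarrow> 'g" and i :: "'g \<Rightarrow> 'g"
  assumes units_subset: "X \<subseteq> G"
    and source_in_units: "\<xi> \<in> G \<Longrightarrow> d \<xi> \<in> X"
    and range_in_units: "\<xi> \<in> G \<Longrightarrow> r \<xi> \<in> X"
    and source_unit: "x \<in> X \<Longrightarrow> d x = x"
    and range_unit: "x \<in> X \<Longrightarrow> r x = x"
    and mult_closed: "\<lbrakk>\<xi> \<in> G; \<eta> \<in> G; d \<xi> = r \<eta>\<rbrakk> \<Longrightarrow> m \<xi> \<eta> \<in> G"
    and source_mult: "\<lbrakk>\<xi> \<in> G; \<eta> \<in> G; d \<xi> = r \<eta>\<rbrakk> \<Longrightarrow> d (m \<xi> \<eta>) = d \<eta>"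
    and range_mult: "\<lbrakk>\<xi> \<in> G; \<eta> \<in> G; d \<xi> = r \<eta>\<rbrakk> \<Longrightarrow> r (m \<xi> \<eta>) = r \<xi>"
    and mult_assoc: "\<lbrakk>\<xi> \<in> G; \<eta> \<in> G; \<zeta> \<in> G; d \<xi> = r \<eta>; d \<eta> = r \<zeta>\<rbrakk>
          \<Longrightarrow> m (m \<xi> \<eta>) \<zeta> = m \<xi> (m \<eta> \<zeta>)"
    and mult_source: "\<xi> \<in> G \<Longrightarrow> m \<xi> (d \<xi>) = \<xi>"
    and range_mult_self: "\<xi> \<in> G \<Longrightarrow> m (r \<xi>) \<xi> = \<xi>"
    and inv_closed: "\<xi> \<in> G \<Longrightarrow> i \<xi> \<in> G"
    and source_inv: "\<xi> \<in> G \<Longrightarrow> d (i \<xi>) = r \<xi>"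
    and range_inv: "\<xi> \<in> G \<Longrightarrow> r (i \<xi>) = d \<xi>"
    and inv_left: "\<xi> \<in> G \<Longrightarrow> m (i \<xi>) \<xi> = d \<xi>"
    and inv_right: "\<xi> \<in> G \<Longrightarrow> m \<xi> (i \<xi>) = r \<xi>"

locale topological_groupoid = groupoid "topspace \<Xi>" X d r m i
  for \<Xi> :: "'g topology" and X :: "'g set"
    and d :: "'g \<Rightarrow> 'g" and r :: "'g \<Rightarrow> 'g"
    and m :: "'g \<Rightarrow> 'g \<Rightarrow> 'g" and i :: "'g \<Rightarrow> 'g" +
  assumes Hausdorff_groupoid: "Hausdorff_space \<Xi>"
    and continuous_inv: "continuous_map \<Xi> \<Xi> i"
    and continuous_mult:
      "continuous_map
         (subtopology (prod_topology \<Xi> \<Xi>)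
            {(\<xi>, \<eta>). \<xi> \<in> topspace \<Xi> \<and> \<eta> \<in> topspace \<Xi> \<and> d \<xi> = r \<eta>})
         \<Xi> (\<lambda>(\<xi>, \<eta>). m \<xi> \<eta>)"

locale continuous_groupoid_action = topological_groupoid \<Xi> X d r m i
  for \<Xi> :: "'g topology" and X :: "'g set"
    and d :: "'g \<Rightarrow> 'g" and r :: "'g \<Rightarrow> 'g"
    and m :: "'g \<Rightarrow> 'g \<Rightarrow> 'g" and i :: "'g \<Rightarrow> 'g" +
  fixes \<rho> :: "'s \<Rightarrow> 'g" and \<theta> :: "'g \<Rightarrow> 's \<Rightarrow> 's" and \<Sigma> :: "'s topology"
  assumes Hausdorff_action_space: "Hausdorff_space \<Sigma>"
    and continuous_anchor: "continuous_map \<Sigma> (subtopology \<Xi> X) \<rho>"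
    and surjective_anchor: "\<rho> ` topspace \<Sigma> = X"
    and continuous_action:
      "continuous_map
         (subtopology (prod_topology \<Xi> \<Sigma>)
            {(\<xi>, \<sigma>). \<xi> \<in> topspace \<Xi> \<and> \<sigma> \<in> topspace \<Sigma> \<and> d \<xi> = \<rho> \<sigma>})
         \<Sigma> (\<lambda>(\<xi>, \<sigma>). \<theta> \<xi> \<sigma>)"
    and action_unit: "\<sigma> \<in> topspace \<Sigma> \<Longrightarrow> \<theta> (\<rho> \<sigma>) \<sigma> = \<sigma>"
    and anchor_action:
      "\<lbrakk>\<xi> \<in> topspace \<Xi>; \<eta> \<in> topspace \<Xi>; \<sigma> \<in> topspace \<Sigma>; d \<xi> = r \<eta>; d \<eta> = \<rho> \<sigma>\<rbrakk>
         \<Longrightarrow> d \<xi> = \<rho> (\<theta> \<eta> \<sigma>)"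
    and action_mult:
      "\<lbrakk>\<xi> \<in> topspace \<Xi>; \<eta> \<in> topspace \<Xi>; \<sigma> \<in> topspace \<Sigma>; d \<xi> = r \<eta>; d \<eta> = \<rho> \<sigma>\<rbrakk>
         \<Longrightarrow> \<theta> (m \<xi> \<eta>) \<sigma> = \<theta> \<xi> (\<theta> \<eta> \<sigma>)"

definition open_groupoid :: "'g topology \<Rightarrow> 'g set \<Rightarrow> ('g \<Rightarrow> 'g) \<Rightarrow> bool" where
  "open_groupoid \<Xi> X d \<longleftrightarrow> open_map \<Xi> (subtopology \<Xi> X) d"

definition source_fibre :: "'g topology \<Rightarrow> ('g \<Rightarrow> 'g) \<Rightarrow> 'g \<Rightarrow> 'g set" where
  "source_fibre \<Xi> d x = {\<xi> \<in> topspace \<Xi>. d \<xi> = x}"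

definition groupoid_set_mult ::
  "('g \<Rightarrow> 'g) \<Rightarrow> ('g \<Rightarrow> 'g) \<Rightarrow> ('g \<Rightarrow> 'g \<Rightarrow> 'g) \<Rightarrow> 'g set \<Rightarrow> 'g set \<Rightarrow> 'g set" where
  "groupoid_set_mult d r m A B = {m \<xi> \<eta> |\<xi> \<eta>. \<xi> \<in> A \<and> \<eta> \<in> B \<and> d \<xi> = r \<eta>}"

definition syndetic_in_fibre ::
  "'g topology \<Rightarrow> ('g \<Rightarrow> 'g) \<Rightarrow> ('g \<Rightarrow> 'g) \<Rightarrow> ('g \<Rightarrow> 'g \<Rightarrow> 'g) \<Rightarrow> 'g \<Rightarrow> 'g set \<Rightarrow> bool" where
  "syndetic_in_fibre \<Xi> d r m x A \<longleftrightarrow>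
     A \<subseteq> source_fibre \<Xi> d x \<and>
     (\<exists>K. compactin \<Xi> K \<and> groupoid_set_mult d r m K A = source_fibre \<Xi> d x)"

definition action_orbit ::
  "'g topology \<Rightarrow> ('g \<Rightarrow> 'g) \<Rightarrow> ('s \<Rightarrow> 'g) \<Rightarrow> ('g \<Rightarrow> 's \<Rightarrow> 's) \<Rightarrow> 's \<Rightarrow> 's set" where
  "action_orbit \<Xi> d \<rho> \<theta> \<sigma> = {\<theta> \<xi> \<sigma> |\<xi>. \<xi> \<in> source_fibre \<Xi> d (\<rho> \<sigma>)}"

definition action_stabilizer ::
  "'g topology \<Rightarrow> ('g \<Rightarrow> 'g) \<Rightarrow> ('s \<Rightarrow> 'g) \<Rightarrow> ('g \<Rightarrow> 's \<Rightarrow> 's) \<Rightarrow> 's \<Rightarrow> 'g set" where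
  "action_stabilizer \<Xi> d \<rho> \<theta> \<sigma> = {\<xi> \<in> source_fibre \<Xi> d (\<rho> \<sigma>). \<theta> \<xi> \<sigma> = \<sigma>}"

definition periodic_point ::
  "'g topology \<Rightarrow> ('g \<Rightarrow> 'g) \<Rightarrow> ('g \<Rightarrow> 'g) \<Rightarrow> ('g \<Rightarrow> 'g \<Rightarrow> 'g) \<Rightarrow>
     ('s \<Rightarrow> 'g) \<Rightarrow> ('g \<Rightarrow> 's \<Rightarrow> 's) \<Rightarrow> 's \<Rightarrow> bool" where
  "periodic_point \<Xi> d r m \<rho> \<theta> \<sigma> \<longleftrightarrow>
     syndetic_in_fibre \<Xi> d r m (\<rho> \<sigma>) (action_stabilizer \<Xi> d \<rho> \<theta> \<sigma>)"

end

theory Submission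
  imports Defs
begin

text \<open>
  Let \<open>x = \<rho> \<sigma>\<close>, let \<open>O\<close> be the orbit of \<open>\<sigma>\<close> and let \<open>\<pi>\<close> be the orbit map \<open>\<xi> \<mapsto> \<xi> \<bullet> \<sigma>\<close> from
  \<open>\<Xi>\<^sub>x\<close> onto \<open>O\<close>. Two arrows of \<open>\<Xi>\<^sub>x\<close> with the same image under \<open>\<pi>\<close> differ by right
  multiplication by a stabilizer arrow. Hence a compact \<open>K \<subseteq> \<Xi>\<^sub>x\<close> satisfies
  \<open>K Stab(\<sigma>) = \<Xi>\<^sub>x\<close> as soon as \<open>\<pi>(K) = O\<close>, and the task is to lift the compact set \<open>O\<close> to a
  compact set of arrows (\<open>orbit_compact_lift\<close>).

  Such a lift exists locally by Baire's theorem: \<open>\<Xi>\<^sub>x\<close> is covered by countably many compact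
  sets, so \<open>O\<close> is covered by their countably many compact images, and one of these has an interior
  point in the compact Hausdorff space \<open>O\<close> (\<open>orbit_compact_lift_interior\<close>).

  The local lift must then be moved around the orbit. A single arrow acts on one fibre of \<open>\<rho>\<close>
  only, so, unlike for a group action, its translates of an open set need not be open. Whole open
  sets of arrows do better: if \<open>\<Xi>\<close> is open, then \<open>U \<bullet> W\<close> is open for all open
  \<open>U \<subseteq> \<Xi>\<close> and \<open>W \<subseteq> \<Sigma>\<close> (\<open>openin_action_set_mult\<close>). Taking \<open>U\<close> inside
  a compact neighbourhood \<open>L\<close> of an arrow, one sees that every point of \<open>O\<close> has a relatively open
  neighbourhood covered by \<open>\<pi>(L K)\<close>, where \<open>L K\<close> is again compact. Finitely many of these
  neighbourhoods cover \<open>O\<close>.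
\<close>

section \<open>Preliminaries on topological spaces\<close>

text \<open>
  Openness passes to pullbacks: over a basic open set \<open>U \<times> V\<close> the projection has image
  \<open>V \<inter> g\<^sup>-\<^sup>1(f(U))\<close>.
\<close>

lemma open_map_pullback_snd:
  assumes f: "open_map A Z f" and g: "continuous_map B Z g"
  shows "open_map
           (subtopology (prod_topology A B)
              {(a, b). a \<in> topspace A \<and> b \<in> topspace B \<and> f a = g b}) B snd"
  unfolding open_map_def
proof (intro allI impI)
  fix P
  assume "openin (subtopology (prod_topology A B)
            {(a, b). a \<in> topspace A \<and> b \<in> topspace B \<and> f a = g b}) P"
  then obtain Q where Q: "openin (prod_topology A B) Q"
    and P: "P = Q \<inter> {(a, b). a \<in> topspace A \<and> b \<in> topspace B \<and> f a = g b}"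
    by (auto simp: openin_subtopology)
  show "openin B (snd ` P)"
  proof (subst openin_subopen, intro ballI)
    fix b assume "b \<in> snd ` P"
    then obtain a where ab: "(a, b) \<in> Q" "a \<in> topspace A" "b \<in> topspace B" "f a = g b"
      using P by auto
    obtain U V where UV: "openin A U" "openin B V" "a \<in> U" "b \<in> V" "U \<times> V \<subseteq> Q"
      using Q ab(1) unfolding openin_prod_topology_alt by meson
    define N where "N = V \<inter> {y \<in> topspace B. g y \<in> f ` U}"
    have "openin Z (f ` U)"
      using f UV(1) by (simp add: open_map_def)
    then have "openin B N"
      unfolding N_def using UV(2) g by (intro openin_Int openin_continuous_map_preimage)
    moreover have "b \<in> N"
      using UV(3,4) ab by (auto simp: N_def intro: image_eqI[of _ f a])
    moreover have "N \<subseteq> snd ` P"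
    proof
      fix y assume "y \<in> N"
      then obtain u where "u \<in> U" "f u = g y" "y \<in> V" "y \<in> topspace B"
        by (auto simp: N_def)
      then have "(u, y) \<in> P"
        using UV openin_subset[OF UV(1)] by (auto simp: P)
      then show "y \<in> snd ` P" by force
    qed
    ultimately show "\<exists>T. openin B T \<and> b \<in> T \<and> T \<subseteq> snd ` P" by blast
  qed
qed

lemma locally_compact_second_countable_imp_sigma_compact:
  assumes "locally_compact_space A" and "second_countable A"
  obtains \<K> where "countable \<K>" and "\<And>K. K \<in> \<K> \<Longrightarrow> compactin A K" and "\<Union>\<K> = topspace A"
proof -
  define \<U> where "\<U> = {U. openin A U \<and> (\<exists>K. compactin A K \<and> U \<subseteq> K)}"
  have "\<Union>\<U> = topspace A"
    using assms(1) openin_subset unfolding locally_compact_space_def \<U>_def by fast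
  then obtain \<V> where \<V>: "countable \<V>" "\<V> \<subseteq> \<U>" "\<Union>\<V> = topspace A"
    using Lindelof_spaceD[OF second_countable_imp_Lindelof_space[OF assms(2)], of \<U>]
    by (auto simp: \<U>_def)
  have "\<forall>V\<in>\<V>. \<exists>K. compactin A K \<and> V \<subseteq> K"
    using \<V>(2) by (auto simp: \<U>_def)
  then obtain k where k: "\<And>V. V \<in> \<V> \<Longrightarrow> compactin A (k V) \<and> V \<subseteq> k V"
    by metis
  show thesis
  proof
    show "countable (k ` \<V>)" using \<V>(1) by simp
    show "compactin A K" if "K \<in> k ` \<V>" for K using that k by auto
    show "\<Union> (k ` \<V>) = topspace A"
    proof
      show "\<Union> (k ` \<V>) \<subseteq> topspace A"
        by (intro UN_least compactin_subset_topspace) (simp add: k)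
      have "\<Union>\<V> \<subseteq> \<Union> (k ` \<V>)"
        using k by (auto dest!: bspec)
      then show "topspace A \<subseteq> \<Union> (k ` \<V>)" by (simp add: \<V>(3))
    qed
  qed
qed

section \<open>Topological groupoids\<close>

lemma (in groupoid) inv_inv:
  assumes "\<xi> \<in> G"
  shows "i (i \<xi>) = \<xi>"
proof -
  have "i (i \<xi>) = m (i (i \<xi>)) (m (i \<xi>) \<xi>)"
    using mult_source[of "i (i \<xi>)"] assms by (simp add: inv_closed source_inv range_inv inv_left)
  also have "\<dots> = m (m (i (i \<xi>)) (i \<xi>)) \<xi>"
    using assms by (simp add: mult_assoc inv_closed source_inv range_inv)
  also have "\<dots> = \<xi>"
    using assms by (simp add: inv_left inv_closed source_inv range_mult_self)
  finally show ?thesis .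
qed

context topological_groupoid
begin

lemma continuous_source: "continuous_map \<Xi> \<Xi> d"
proof -
  have "continuous_map \<Xi>
      (subtopology (prod_topology \<Xi> \<Xi>)
         {(\<xi>, \<eta>). \<xi> \<in> topspace \<Xi> \<and> \<eta> \<in> topspace \<Xi> \<and> d \<xi> = r \<eta>}) (\<lambda>\<xi>. (i \<xi>, \<xi>))"
    by (auto simp: continuous_map_in_subtopology continuous_map_paired continuous_inv
        inv_closed source_inv)
  from continuous_map_compose[OF this continuous_mult]
  show ?thesis
    by (rule continuous_map_eq) (simp add: inv_left)
qed

lemma continuous_range: "continuous_map \<Xi> \<Xi> r"
  using continuous_map_compose[OF continuous_inv continuous_source]
  by (rule continuous_map_eq) (simp add: source_inv)

lemma closedin_source_fibre: "closedin \<Xi> (source_fibre \<Xi> d x)"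
proof (cases "x \<in> topspace \<Xi>")
  case True
  then show ?thesis
    using closedin_continuous_maps_eq[OF Hausdorff_groupoid continuous_source, of "\<lambda>_. x"]
    by (simp add: source_fibre_def)
next
  case False
  then have "source_fibre \<Xi> d x = {}"
    using source_in_units units_subset by (auto simp: source_fibre_def)
  then show ?thesis by simp
qed

text \<open>
  Composability is a closed condition because \<open>\<Xi>\<close> is Hausdorff, so only a closed part of
  \<open>K \<times> L\<close> is multiplied.
\<close>

lemma compactin_groupoid_set_mult:
  assumes "compactin \<Xi> K" and "compactin \<Xi> L"
  shows "compactin \<Xi> (groupoid_set_mult d r m K L)"
proof -
  define D where "D = {(\<xi>, \<eta>). \<xi> \<in> topspace \<Xi> \<and> \<eta> \<in> topspace \<Xi> \<and> d \<xi> = r \<eta>}"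
  have "closedin (prod_topology \<Xi> \<Xi>)
      {p \<in> topspace (prod_topology \<Xi> \<Xi>). (d \<circ> fst) p = (r \<circ> snd) p}"
    by (intro closedin_continuous_maps_eq[OF Hausdorff_groupoid]
        continuous_map_compose[OF continuous_map_fst continuous_source]
        continuous_map_compose[OF continuous_map_snd continuous_range])
  also have "{p \<in> topspace (prod_topology \<Xi> \<Xi>). (d \<circ> fst) p = (r \<circ> snd) p} = D"
    by (auto simp: D_def)
  finally have "compactin (prod_topology \<Xi> \<Xi>) (D \<inter> K \<times> L)"
    using assms by (intro closed_Int_compactin) (auto simp: compactin_Times)
  then have "compactin (subtopology (prod_topology \<Xi> \<Xi>) D) (D \<inter> K \<times> L)"
    by (simp add: compactin_subtopology)
  then have "compactin \<Xi> ((\<lambda>(\<xi>, \<eta>). m \<xi> \<eta>) ` (D \<inter> K \<times> L))"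
    using continuous_mult unfolding D_def by (rule image_compactin)
  also have "(\<lambda>(\<xi>, \<eta>). m \<xi> \<eta>) ` (D \<inter> K \<times> L) = groupoid_set_mult d r m K L"
    using assms[THEN compactin_subset_topspace]
    by (force simp: D_def groupoid_set_mult_def)
  finally show ?thesis .
qed

lemma open_map_range:
  assumes "open_groupoid \<Xi> X d"
  shows "open_map \<Xi> (subtopology \<Xi> X) r"
  unfolding open_map_def
proof (intro allI impI)
  fix U assume U: "openin \<Xi> U"
  have sub: "U \<subseteq> topspace \<Xi>" using U by (rule openin_subset)
  have "openin \<Xi> {\<xi> \<in> topspace \<Xi>. i \<xi> \<in> U}"
    using continuous_inv U by (rule openin_continuous_map_preimage)
  then have "openin (subtopology \<Xi> X) (d ` {\<xi> \<in> topspace \<Xi>. i \<xi> \<in> U})"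
    using assms by (simp add: open_groupoid_def open_map_def)
  also have "{\<xi> \<in> topspace \<Xi>. i \<xi> \<in> U} = i ` U"
    using sub by (force simp: inv_inv inv_closed intro: image_eqI[of _ i "i _"])
  also have "d ` (i ` U) = r ` U"
    using sub by (auto simp: image_image source_inv subset_iff cong: image_cong_simp)
  finally show "openin (subtopology \<Xi> X) (r ` U)" .
qed

end

section \<open>Translating open sets by open sets of arrows\<close>

definition action_set_mult ::
  "('g \<Rightarrow> 'g) \<Rightarrow> ('s \<Rightarrow> 'g) \<Rightarrow> ('g \<Rightarrow> 's \<Rightarrow> 's) \<Rightarrow> 'g set \<Rightarrow> 's set \<Rightarrow> 's set" where
  "action_set_mult d \<rho> \<theta> U W = {\<theta> \<xi> \<tau> |\<xi> \<tau>. \<xi> \<in> U \<and> \<tau> \<in> W \<and> d \<xi> = \<rho> \<tau>}"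

context continuous_groupoid_action
begin

lemma anchor_in_units: "\<tau> \<in> topspace \<Sigma> \<Longrightarrow> \<rho> \<tau> \<in> X"
  using surjective_anchor by blast

lemma action_closed:
  "\<lbrakk>\<xi> \<in> topspace \<Xi>; \<tau> \<in> topspace \<Sigma>; d \<xi> = \<rho> \<tau>\<rbrakk> \<Longrightarrow> \<theta> \<xi> \<tau> \<in> topspace \<Sigma>"
  using continuous_map_image_subset_topspace[OF continuous_action] by (force simp: image_subset_iff)

lemma anchor_action_eq_range:
  assumes "\<xi> \<in> topspace \<Xi>" "\<tau> \<in> topspace \<Sigma>" "d \<xi> = \<rho> \<tau>"
  shows "\<rho> (\<theta> \<xi> \<tau>) = r \<xi>"
proof -
  have "r \<xi> \<in> X" using assms(1) by (rule range_in_units)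
  then show ?thesis
    using anchor_action[of "r \<xi>" \<xi> \<tau>] assms units_subset by (auto simp: source_unit)
qed

lemma action_inv_action:
  assumes "\<xi> \<in> topspace \<Xi>" "\<tau> \<in> topspace \<Sigma>" "d \<xi> = \<rho> \<tau>"
  shows "\<theta> (i \<xi>) (\<theta> \<xi> \<tau>) = \<tau>"
  using action_mult[of "i \<xi>" \<xi> \<tau>] assms
  by (simp add: inv_closed source_inv inv_left action_unit)

lemma action_action_inv:
  assumes "\<xi> \<in> topspace \<Xi>" "\<tau> \<in> topspace \<Sigma>" "r \<xi> = \<rho> \<tau>"
  shows "\<theta> \<xi> (\<theta> (i \<xi>) \<tau>) = \<tau>"
  using action_inv_action[of "i \<xi>" \<tau>] assms by (simp add: inv_closed source_inv inv_inv)

text \<open>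
  A point \<open>\<tau>\<close> lies in \<open>U \<bullet> W\<close> iff \<open>\<xi>\<^sup>-\<^sup>1 \<bullet> \<tau> \<in> W\<close> for some \<open>\<xi> \<in> U\<close> with
  \<open>r \<xi> = \<rho> \<tau>\<close>. These pairs \<open>(\<xi>, \<tau>)\<close> form an open subset of the pullback of \<open>r\<close> along \<open>\<rho>\<close>, and
  the projection of that pullback to \<open>\<Sigma>\<close> is open because \<open>r\<close> is.
\<close>

lemma openin_action_set_mult:
  assumes "open_groupoid \<Xi> X d" and U: "openin \<Xi> U" and W: "openin \<Sigma> W"
  shows "openin \<Sigma> (action_set_mult d \<rho> \<theta> U W)"
proof -
  define D where "D = {(\<xi>, \<tau>). \<xi> \<in> topspace \<Xi> \<and> \<tau> \<in> topspace \<Sigma> \<and> r \<xi> = \<rho> \<tau>}"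
  define T where "T = subtopology (prod_topology \<Xi> \<Sigma>) D"
  have topT: "topspace T = D"
    by (auto simp: T_def D_def)
  have fst: "continuous_map T \<Xi> fst" and snd: "continuous_map T \<Sigma> snd"
    unfolding T_def
    by (intro continuous_map_from_subtopology continuous_map_fst continuous_map_snd)+
  have "continuous_map T (prod_topology \<Xi> \<Sigma>) (\<lambda>p. (i (fst p), snd p))"
    using continuous_map_compose[OF fst continuous_inv] snd
    by (simp add: continuous_map_paired o_def)
  then have "continuous_map T
      (subtopology (prod_topology \<Xi> \<Sigma>)
         {(\<xi>, \<tau>). \<xi> \<in> topspace \<Xi> \<and> \<tau> \<in> topspace \<Sigma> \<and> d \<xi> = \<rho> \<tau>})
      (\<lambda>p. (i (fst p), snd p))"
    by (auto simp: continuous_map_in_subtopology topT D_def inv_closed source_inv)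
  from continuous_map_compose[OF this continuous_action]
  have "continuous_map T \<Sigma> (\<lambda>p. \<theta> (i (fst p)) (snd p))"
    by (simp add: o_def)
  then have "openin T ({p \<in> topspace T. fst p \<in> U} \<inter> {p \<in> topspace T. \<theta> (i (fst p)) (snd p) \<in> W})"
    (is "openin T ?P")
    using fst U W by (intro openin_Int openin_continuous_map_preimage)
  moreover have "open_map T \<Sigma> snd"
    unfolding T_def D_def
    using open_map_range[OF assms(1)] continuous_anchor by (rule open_map_pullback_snd)
  ultimately have "openin \<Sigma> (snd ` ?P)"
    by (simp add: open_map_def)
  also have "snd ` ?P = action_set_mult d \<rho> \<theta> U W"
  proof (intro set_eqI iffI)
    fix \<tau> assume "\<tau> \<in> snd ` ?P"
    then obtain \<xi> where \<xi>: "\<xi> \<in> topspace \<Xi>" "\<tau> \<in> topspace \<Sigma>" "r \<xi> = \<rho> \<tau>" "\<xi> \<in> U"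
      "\<theta> (i \<xi>) \<tau> \<in> W"
      by (auto simp: topT D_def)
    then have "\<tau> = \<theta> \<xi> (\<theta> (i \<xi>) \<tau>)" "d \<xi> = \<rho> (\<theta> (i \<xi>) \<tau>)"
      by (simp_all add: action_action_inv anchor_action_eq_range inv_closed source_inv range_inv)
    then show "\<tau> \<in> action_set_mult d \<rho> \<theta> U W"
      using \<xi> by (auto simp: action_set_mult_def)
  next
    fix \<tau> assume "\<tau> \<in> action_set_mult d \<rho> \<theta> U W"
    then obtain \<xi> \<upsilon> where *: "\<tau> = \<theta> \<xi> \<upsilon>" "\<xi> \<in> U" "\<upsilon> \<in> W" "d \<xi> = \<rho> \<upsilon>"
      by (auto simp: action_set_mult_def)
    have "\<xi> \<in> topspace \<Xi>" "\<upsilon> \<in> topspace \<Sigma>"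
      using * U W openin_subset by blast+
    then have "(\<xi>, \<tau>) \<in> ?P"
      using * by (simp add: topT D_def action_closed anchor_action_eq_range action_inv_action)
    then show "\<tau> \<in> snd ` ?P" by force
  qed
  finally show ?thesis .
qed

section \<open>Compact lifts of a compact orbit\<close>

lemma action_orbit_eq_image:
  "action_orbit \<Xi> d \<rho> \<theta> \<sigma> = (\<lambda>\<xi>. \<theta> \<xi> \<sigma>) ` source_fibre \<Xi> d (\<rho> \<sigma>)"
  by (auto simp: action_orbit_def)

lemma continuous_orbit_map:
  assumes "\<sigma> \<in> topspace \<Sigma>"
  shows "continuous_map (subtopology \<Xi> (source_fibre \<Xi> d (\<rho> \<sigma>))) \<Sigma> (\<lambda>\<xi>. \<theta> \<xi> \<sigma>)"
proof -
  have "continuous_map (subtopology \<Xi> (source_fibre \<Xi> d (\<rho> \<sigma>)))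
      (subtopology (prod_topology \<Xi> \<Sigma>)
         {(\<xi>, \<sigma>). \<xi> \<in> topspace \<Xi> \<and> \<sigma> \<in> topspace \<Sigma> \<and> d \<xi> = \<rho> \<sigma>}) (\<lambda>\<xi>. (\<xi>, \<sigma>))"
    using assms by (auto simp: continuous_map_in_subtopology continuous_map_paired
        source_fibre_def continuous_map_from_subtopology)
  from continuous_map_compose[OF this continuous_action]
  show ?thesis by (simp add: o_def)
qed

lemma groupoid_set_mult_in_source_fibre:
  assumes "L \<subseteq> topspace \<Xi>" and "A \<subseteq> source_fibre \<Xi> d x"
  shows "groupoid_set_mult d r m L A \<subseteq> source_fibre \<Xi> d x"
  using assms by (force simp: groupoid_set_mult_def source_fibre_def mult_closed source_mult)

text \<open>
  The images of countably many compact pieces of the source fibre are closed and cover the orbit,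
  so by Baire's theorem they cannot all have empty interior.
\<close>

lemma orbit_compact_lift_interior:
  assumes lc: "locally_compact_space \<Xi>" and sc: "second_countable \<Xi>"
    and \<sigma>: "\<sigma> \<in> topspace \<Sigma>" and orb: "compactin \<Sigma> (action_orbit \<Xi> d \<rho> \<theta> \<sigma>)"
  obtains K where "compactin \<Xi> K" and "K \<subseteq> source_fibre \<Xi> d (\<rho> \<sigma>)"
    and "subtopology \<Sigma> (action_orbit \<Xi> d \<rho> \<theta> \<sigma>) interior_of ((\<lambda>\<xi>. \<theta> \<xi> \<sigma>) ` K) \<noteq> {}"
proof -
  define F where "F = source_fibre \<Xi> d (\<rho> \<sigma>)"
  define \<pi> where "\<pi> = (\<lambda>\<xi>. \<theta> \<xi> \<sigma>)"
  define T where "T = subtopology \<Sigma> (action_orbit \<Xi> d \<rho> \<theta> \<sigma>)"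
  have orbit: "action_orbit \<Xi> d \<rho> \<theta> \<sigma> = \<pi> ` F"
    by (simp add: action_orbit_eq_image F_def \<pi>_def)
  have T: "topspace T = \<pi> ` F"
    using compactin_subset_topspace[OF orb] by (auto simp: T_def orbit)
  have Haus: "Hausdorff_space T"
    unfolding T_def using Hausdorff_action_space by (rule Hausdorff_space_subtopology)
  have comp: "compact_space T"
    unfolding T_def using orb by (rule compact_space_subtopology)
  obtain \<K> where \<K>: "countable \<K>" "\<And>K. K \<in> \<K> \<Longrightarrow> compactin \<Xi> K" "\<Union>\<K> = topspace \<Xi>"
    using locally_compact_second_countable_imp_sigma_compact[OF lc sc] by blast
  have FK: "compactin \<Xi> (F \<inter> K)" if "K \<in> \<K>" for K
    unfolding F_def by (rule closed_Int_compactin[OF closedin_source_fibre \<K>(2)[OF that]])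
  have closed: "closedin T (\<pi> ` (F \<inter> K))" if "K \<in> \<K>" for K
  proof (rule compactin_imp_closedin[OF Haus])
    have "compactin (subtopology \<Xi> F) (F \<inter> K)"
      using FK[OF that] by (simp add: compactin_subtopology)
    then have "compactin \<Sigma> (\<pi> ` (F \<inter> K))"
      using continuous_orbit_map[OF \<sigma>] unfolding F_def \<pi>_def by (rule image_compactin)
    then show "compactin T (\<pi> ` (F \<inter> K))"
      by (auto simp: T_def orbit compactin_subtopology)
  qed
  have cover: "\<Union> ((\<lambda>K. \<pi> ` (F \<inter> K)) ` \<K>) = topspace T"
  proof -
    have "F \<subseteq> \<Union>\<K>" by (auto simp: \<K>(3) F_def source_fibre_def)
    then show ?thesis by (auto simp: T)
  qed
  have "\<exists>K\<in>\<K>. T interior_of (\<pi> ` (F \<inter> K)) \<noteq> {}"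
  proof (rule ccontr)
    assume none: "\<not> ?thesis"
    have "T interior_of \<Union> ((\<lambda>K. \<pi> ` (F \<inter> K)) ` \<K>) = {}"
    proof (rule Baire_category_alt)
      show "completely_metrizable_space T \<or> locally_compact_space T \<and> regular_space T"
        using Haus comp compact_Hausdorff_or_regular_imp_normal_space
          compact_Hausdorff_imp_regular_space compact_imp_locally_compact_space by blast
      show "countable ((\<lambda>K. \<pi> ` (F \<inter> K)) ` \<K>)" using \<K>(1) by simp
      show "closedin T S \<and> T interior_of S = {}" if "S \<in> (\<lambda>K. \<pi> ` (F \<inter> K)) ` \<K>" for S
        using that closed none by auto
    qed
    then have "topspace T = {}" by (simp add: cover)
    moreover have "\<rho> \<sigma> \<in> F"
      using anchor_in_units[OF \<sigma>] units_subset by (auto simp: F_def source_fibre_def source_unit)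
    ultimately show False by (auto simp: T)
  qed
  then obtain K where "K \<in> \<K>" "T interior_of (\<pi> ` (F \<inter> K)) \<noteq> {}" by blast
  then show thesis
    using that[of "F \<inter> K"] FK by (simp add: T_def \<pi>_def F_def)
qed

text \<open>
  Let \<open>A\<close> be the interior, relative to the orbit, of the image of a compact set \<open>K\<close> of arrows. Every
  point of the orbit has the form \<open>\<zeta> \<bullet> \<upsilon>\<close> with \<open>\<upsilon> \<in> A\<close>. If \<open>U\<close> is an open
  neighbourhood of \<open>\<zeta>\<close> contained in a compact set \<open>L\<close>, then the neighbourhood \<open>U \<bullet> A\<close> of the point
  lifts into the compact set \<open>L K\<close>.
\<close>

lemma orbit_compact_lift:
  assumes lc: "locally_compact_space \<Xi>" and sc: "second_countable \<Xi>"
    and og: "open_groupoid \<Xi> X d"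
    and \<sigma>: "\<sigma> \<in> topspace \<Sigma>" and orb: "compactin \<Sigma> (action_orbit \<Xi> d \<rho> \<theta> \<sigma>)"
  obtains K where "compactin \<Xi> K" and "K \<subseteq> source_fibre \<Xi> d (\<rho> \<sigma>)"
    and "action_orbit \<Xi> d \<rho> \<theta> \<sigma> \<subseteq> (\<lambda>\<xi>. \<theta> \<xi> \<sigma>) ` K"
proof -
  define F where "F = source_fibre \<Xi> d (\<rho> \<sigma>)"
  define \<pi> where "\<pi> = (\<lambda>\<xi>. \<theta> \<xi> \<sigma>)"
  define Orb where "Orb = action_orbit \<Xi> d \<rho> \<theta> \<sigma>"
  have orbit: "Orb = \<pi> ` F"
    by (simp add: Orb_def action_orbit_eq_image F_def \<pi>_def)
  have F: "\<xi> \<in> topspace \<Xi>" "d \<xi> = \<rho> \<sigma>" if "\<xi> \<in> F" for \<xi>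
    using that by (auto simp: F_def source_fibre_def)
  obtain K0 where K0: "compactin \<Xi> K0" "K0 \<subseteq> F"
    and int: "subtopology \<Sigma> Orb interior_of (\<pi> ` K0) \<noteq> {}"
    using orbit_compact_lift_interior[OF lc sc \<sigma> orb] unfolding F_def \<pi>_def Orb_def by blast
  obtain W where W: "openin \<Sigma> W"
    and A: "subtopology \<Sigma> Orb interior_of (\<pi> ` K0) = W \<inter> Orb"
    using openin_interior_of[of "subtopology \<Sigma> Orb" "\<pi> ` K0"] unfolding openin_subtopology by blast
  have A_lift: "W \<inter> Orb \<subseteq> \<pi> ` K0"
    using interior_of_subset A by metis
  obtain \<eta> where \<eta>: "\<eta> \<in> F" "\<pi> \<eta> \<in> W"
    using int unfolding A by (auto simp: orbit)
  \<comment> \<open>Open sets of points whose trace on the orbit lifts into a compact set of arrows.\<close>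
  define \<V> where "\<V> = {V. openin \<Sigma> V \<and> (\<exists>K. compactin \<Xi> K \<and> K \<subseteq> F \<and> V \<inter> Orb \<subseteq> \<pi> ` K)}"
  have "Orb \<subseteq> \<Union>\<V>"
  proof
    fix \<tau> assume "\<tau> \<in> Orb"
    then obtain \<xi> where \<xi>: "\<xi> \<in> F" "\<tau> = \<pi> \<xi>"
      by (auto simp: orbit)
    \<comment> \<open>An arrow from the interior point \<open>\<pi> \<eta>\<close> to \<open>\<tau>\<close>.\<close>
    define \<zeta> where "\<zeta> = m \<xi> (i \<eta>)"
    have \<eta>': "i \<eta> \<in> topspace \<Xi>" "d (i \<eta>) = r \<eta>" "r (i \<eta>) = \<rho> \<sigma>"
      using F[OF \<eta>(1)] by (simp_all add: inv_closed source_inv range_inv)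
    have \<pi>\<eta>: "\<pi> \<eta> \<in> topspace \<Sigma>" "\<rho> (\<pi> \<eta>) = r \<eta>"
      using F[OF \<eta>(1)] \<sigma> by (simp_all add: \<pi>_def action_closed anchor_action_eq_range)
    have \<zeta>: "\<zeta> \<in> topspace \<Xi>" "d \<zeta> = \<rho> (\<pi> \<eta>)"
      using F[OF \<xi>(1)] \<eta>' \<pi>\<eta> by (simp_all add: \<zeta>_def mult_closed source_mult)
    have "\<theta> \<zeta> (\<pi> \<eta>) = \<theta> \<xi> (\<theta> (i \<eta>) (\<pi> \<eta>))"
      unfolding \<zeta>_def using F[OF \<xi>(1)] \<eta>' \<pi>\<eta> by (intro action_mult) simp_all
    also have "\<dots> = \<tau>"
      using F[OF \<eta>(1)] \<sigma> by (simp add: \<pi>_def action_inv_action \<xi>(2))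
    finally have \<tau>: "\<theta> \<zeta> (\<pi> \<eta>) = \<tau>" .
    obtain U L where UL: "openin \<Xi> U" "compactin \<Xi> L" "\<zeta> \<in> U" "U \<subseteq> L"
      using lc \<zeta>(1) unfolding locally_compact_space_def by blast
    have L: "L \<subseteq> topspace \<Xi>" using UL(2) by (rule compactin_subset_topspace)
    define V where "V = action_set_mult d \<rho> \<theta> U W"
    have "openin \<Sigma> V"
      unfolding V_def using og UL(1) W by (rule openin_action_set_mult)
    moreover have "compactin \<Xi> (groupoid_set_mult d r m L K0)"
      using UL(2) K0(1) by (rule compactin_groupoid_set_mult)
    moreover have "groupoid_set_mult d r m L K0 \<subseteq> F"
      using L K0(2) unfolding F_def by (rule groupoid_set_mult_in_source_fibre)
    moreover have "V \<inter> Orb \<subseteq> \<pi> ` groupoid_set_mult d r m L K0"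
    proof
      fix \<tau>' assume "\<tau>' \<in> V \<inter> Orb"
      then obtain \<xi>' \<upsilon> \<kappa> where *: "\<tau>' = \<theta> \<xi>' \<upsilon>" "\<xi>' \<in> U" "\<upsilon> \<in> W" "d \<xi>' = \<rho> \<upsilon>"
        and \<kappa>: "\<kappa> \<in> F" "\<tau>' = \<pi> \<kappa>"
        by (auto simp: V_def action_set_mult_def orbit)
      have \<xi>': "\<xi>' \<in> topspace \<Xi>" using * UL L by blast
      have \<upsilon>: "\<upsilon> \<in> topspace \<Sigma>" using * W openin_subset by blast
      \<comment> \<open>The inverse of \<open>\<xi>'\<close> carries \<open>\<tau>'\<close> back to \<open>\<upsilon>\<close>, and the orbit is invariant.\<close>
      have "\<upsilon> \<in> Orb"
      proof -
        have range: "r \<xi>' = r \<kappa>"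
          using anchor_action_eq_range[OF \<xi>' \<upsilon> *(4)] anchor_action_eq_range[of \<kappa> \<sigma>] F[OF \<kappa>(1)] \<sigma>
            \<kappa>(2) *(1) by (simp add: \<pi>_def)
        have "\<upsilon> = \<theta> (i \<xi>') (\<theta> \<kappa> \<sigma>)"
          using action_inv_action[OF \<xi>' \<upsilon> *(4)] *(1) \<kappa>(2) by (simp add: \<pi>_def)
        also have "\<dots> = \<pi> (m (i \<xi>') \<kappa>)"
          unfolding \<pi>_def using \<xi>' F[OF \<kappa>(1)] \<sigma> range
          by (intro action_mult[symmetric]) (simp_all add: inv_closed source_inv)
        also have "m (i \<xi>') \<kappa> \<in> F"
          using \<xi>' F[OF \<kappa>(1)] range
          by (simp add: F_def source_fibre_def mult_closed source_mult inv_closed source_inv)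
        ultimately show ?thesis by (simp add: orbit)
      qed
      then obtain k where k: "k \<in> K0" "\<upsilon> = \<pi> k"
        using *(3) A_lift by blast
      have kF: "k \<in> F" using k K0 by blast
      have "d \<xi>' = r k"
        using *(4) F[OF kF] \<sigma> by (simp add: k(2) \<pi>_def anchor_action_eq_range)
      then have "m \<xi>' k \<in> groupoid_set_mult d r m L K0" "\<tau>' = \<pi> (m \<xi>' k)"
        using * k(1) UL(4) \<xi>' F[OF kF] \<sigma>
        by (auto simp: groupoid_set_mult_def k(2) \<pi>_def action_mult)
      then show "\<tau>' \<in> \<pi> ` groupoid_set_mult d r m L K0" by blast
    qed
    moreover have "\<tau> \<in> V"
      using UL(3) \<eta>(2) \<zeta>(2) \<tau> by (auto simp: V_def action_set_mult_def)
    ultimately show "\<tau> \<in> \<Union>\<V>" unfolding \<V>_def by blast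
  qed
  then obtain \<F> where \<F>: "finite \<F>" "\<F> \<subseteq> \<V>" "Orb \<subseteq> \<Union>\<F>"
    using compactinD[OF orb, of \<V>] unfolding Orb_def[symmetric] by (auto simp: \<V>_def)
  have "\<forall>V\<in>\<F>. \<exists>K. compactin \<Xi> K \<and> K \<subseteq> F \<and> V \<inter> Orb \<subseteq> \<pi> ` K"
    using \<F>(2) by (auto simp: \<V>_def)
  then obtain k where k: "\<And>V. V \<in> \<F> \<Longrightarrow> compactin \<Xi> (k V) \<and> k V \<subseteq> F \<and> V \<inter> Orb \<subseteq> \<pi> ` k V"
    by metis
  show thesis
  proof (rule that)
    show "compactin \<Xi> (\<Union> (k ` \<F>))"
      using \<F>(1) k by (intro compactin_Union) auto
    show "\<Union> (k ` \<F>) \<subseteq> source_fibre \<Xi> d (\<rho> \<sigma>)"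
      by (rule UN_least) (simp add: k flip: F_def)
    have "Orb \<subseteq> \<pi> ` \<Union> (k ` \<F>)"
    proof
      fix \<tau> assume "\<tau> \<in> Orb"
      with \<F>(3) obtain V where "V \<in> \<F>" "\<tau> \<in> V \<inter> Orb" by blast
      with k[of V] show "\<tau> \<in> \<pi> ` \<Union> (k ` \<F>)" by fast
    qed
    then show "action_orbit \<Xi> d \<rho> \<theta> \<sigma> \<subseteq> (\<lambda>\<xi>. \<theta> \<xi> \<sigma>) ` \<Union> (k ` \<F>)"
      unfolding Orb_def \<pi>_def .
  qed
qed

section \<open>Compact orbits are periodic\<close>

text \<open>
  If \<open>\<xi> \<bullet> \<sigma> = k \<bullet> \<sigma>\<close> with \<open>k \<in> K\<close>, then \<open>\<xi> = k (k\<^sup>-\<^sup>1 \<xi>)\<close>, and \<open>k\<^sup>-\<^sup>1 \<xi>\<close> stabilizes \<open>\<sigma>\<close>.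
\<close>

lemma source_fibre_eq_mult_stabilizer:
  assumes \<sigma>: "\<sigma> \<in> topspace \<Sigma>" and K: "K \<subseteq> source_fibre \<Xi> d (\<rho> \<sigma>)"
    and lift: "action_orbit \<Xi> d \<rho> \<theta> \<sigma> \<subseteq> (\<lambda>\<xi>. \<theta> \<xi> \<sigma>) ` K"
  shows "groupoid_set_mult d r m K (action_stabilizer \<Xi> d \<rho> \<theta> \<sigma>) = source_fibre \<Xi> d (\<rho> \<sigma>)"
proof
  show "groupoid_set_mult d r m K (action_stabilizer \<Xi> d \<rho> \<theta> \<sigma>) \<subseteq> source_fibre \<Xi> d (\<rho> \<sigma>)"
    using K by (intro groupoid_set_mult_in_source_fibre)
      (auto simp: source_fibre_def action_stabilizer_def)
  show "source_fibre \<Xi> d (\<rho> \<sigma>) \<subseteq> groupoid_set_mult d r m K (action_stabilizer \<Xi> d \<rho> \<theta> \<sigma>)"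
  proof
    fix \<xi> assume "\<xi> \<in> source_fibre \<Xi> d (\<rho> \<sigma>)"
    then have \<xi>: "\<xi> \<in> topspace \<Xi>" "d \<xi> = \<rho> \<sigma>" and "\<theta> \<xi> \<sigma> \<in> action_orbit \<Xi> d \<rho> \<theta> \<sigma>"
      by (auto simp: source_fibre_def action_orbit_def)
    then obtain k where k: "k \<in> K" "\<theta> \<xi> \<sigma> = \<theta> k \<sigma>"
      using lift by blast
    have k': "k \<in> topspace \<Xi>" "d k = \<rho> \<sigma>"
      using k(1) K by (auto simp: source_fibre_def)
    have range: "r k = r \<xi>"
      using anchor_action_eq_range[OF \<xi>(1) \<sigma> \<xi>(2)] anchor_action_eq_range[OF k'(1) \<sigma> k'(2)] k(2)
      by simp
    have "\<theta> (m (i k) \<xi>) \<sigma> = \<theta> (i k) (\<theta> k \<sigma>)"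
      using action_mult[of "i k" \<xi> \<sigma>] \<xi> k' k(2) \<sigma> range by (simp add: inv_closed source_inv)
    also have "\<dots> = \<sigma>"
      using k' \<sigma> by (simp add: action_inv_action)
    finally have "m (i k) \<xi> \<in> action_stabilizer \<Xi> d \<rho> \<theta> \<sigma>"
      using \<xi> k' range by (simp add: action_stabilizer_def source_fibre_def mult_closed source_mult
          inv_closed source_inv)
    moreover have "d k = r (m (i k) \<xi>)"
      using \<xi> k' range by (simp add: range_mult inv_closed source_inv range_inv)
    moreover have "m k (m (i k) \<xi>) = \<xi>"
    proof -
      have "m k (m (i k) \<xi>) = m (m k (i k)) \<xi>"
        using \<xi> k' range by (simp add: mult_assoc inv_closed source_inv range_inv)
      then show ?thesis
        using \<xi> k' range by (simp add: inv_right range_mult_self)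
    qed
    ultimately show "\<xi> \<in> groupoid_set_mult d r m K (action_stabilizer \<Xi> d \<rho> \<theta> \<sigma>)"
      using k(1) unfolding groupoid_set_mult_def by force
  qed
qed

end

theorem proposition6p18:
  fixes \<Xi> :: "'g topology" and X :: "'g set"
    and d r i :: "'g \<Rightarrow> 'g" and m :: "'g \<Rightarrow> 'g \<Rightarrow> 'g"
    and \<rho> :: "'s \<Rightarrow> 'g" and \<theta> :: "'g \<Rightarrow> 's \<Rightarrow> 's" and \<Sigma> :: "'s topology"
    and \<sigma> :: 's
  assumes "continuous_groupoid_action \<Xi> X d r m i \<rho> \<theta> \<Sigma>"
    and "locally_compact_space \<Xi>"
    and "second_countable \<Xi>"
    and "open_groupoid \<Xi> X d"
    and "\<sigma> \<in> topspace \<Sigma>"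
    and "compactin \<Sigma> (action_orbit \<Xi> d \<rho> \<theta> \<sigma>)"
  shows "periodic_point \<Xi> d r m \<rho> \<theta> \<sigma>"
proof -
  interpret continuous_groupoid_action \<Xi> X d r m i \<rho> \<theta> \<Sigma> by fact
  obtain K where K: "compactin \<Xi> K" "K \<subseteq> source_fibre \<Xi> d (\<rho> \<sigma>)"
    "action_orbit \<Xi> d \<rho> \<theta> \<sigma> \<subseteq> (\<lambda>\<xi>. \<theta> \<xi> \<sigma>) ` K"
    using orbit_compact_lift[OF assms(2-6)] by blast
  have "action_stabilizer \<Xi> d \<rho> \<theta> \<sigma> \<subseteq> source_fibre \<Xi> d (\<rho> \<sigma>)"
    by (auto simp: action_stabilizer_def)
  then show ?thesis
    using K(1) source_fibre_eq_mult_stabilizer[OF assms(5) K(2,3)]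
    unfolding periodic_point_def syndetic_in_fibre_def by blast
qed

end
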